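(* Let $\Omega\subset\mathbb{R}^n$ be a bounded domain, let $g:\partial\Omega\to\mathbb{R}$ be bounded, and let $u$ be the convex envelope of the boundary data $g$, defined on $\Omega$. Then for every point $x$ inside $\Omega$, $$\lambda_1[u](x)=\min_{|v|=1}\frac{d^2u}{dv^2}(x)=0 .$$
   Context: The convex envelope of the boundary data $g$ is $$u(x)=\sup\{w(x)\mid w:\mathbb{R}^n\to\mathbb{R}\text{ convex},\ w(y)\le g(y)\ \text{for all } y\in\partial\Omega\},$$ where the convex functions $w$ may equivalently be replaced by affine functions. For a unit vector $v\in\mathbb{R}^n$, the second directional derivative of $u$ at $x$ in the direction $v$ is $$\frac{d^2u}{dv^2}(x)=\lim_{h,k\to0^+}\frac{2}{h+k}\left(\frac{u(x+kv)-u(x)}{k}-\frac{u(x)-u(x-hv)}{h}\right),$$ where $h,k\to 0^+$ independently. For the (possibly non-differentiable) function $u$, $\lambda_1[u](x)$ is defined as the minimum of these second directional derivatives over unit vectors $v$ (for $C^2$ functions it is the smallest eigenvalue of the Hessian). The minimum is taken over those unit vectors $v$ for which the limit exists in $[-\infty,+\infty]$. *)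

theory Defs
  imports "HOL-Analysis.Analysis"
begin

text \<open>
  The supremum is taken in the reals. Outside the convex hull of the boundary it may be
  over an unbounded set and hence carry no information; at the points of a bounded open
  \<open>\<Omega>\<close> it is a genuine supremum for bounded \<open>g\<close>, see the lemma below.
\<close>

definition convex_minorants :: "(real^'n) set \<Rightarrow> (real^'n \<Rightarrow> real) \<Rightarrow> (real^'n \<Rightarrow> real) set" where
  "convex_minorants \<Omega> g = {w. convex_on UNIV w \<and> (\<forall>y\<in>frontier \<Omega>. w y \<le> g y)}"

definition convex_envelope :: "(real^'n) set \<Rightarrow> (real^'n \<Rightarrow> real) \<Rightarrow> real^'n \<Rightarrow> real" where
  "convex_envelope \<Omega> g x = (SUP w\<in>convex_minorants \<Omega> g. w x)"

lemma convex_envelope_well_defined: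
  fixes \<Omega> :: "(real^'n) set" and g :: "real^'n \<Rightarrow> real"
  assumes "open \<Omega>" "bounded \<Omega>" and g: "bounded (g ` frontier \<Omega>)" and x: "x \<in> \<Omega>"
  shows "convex_minorants \<Omega> g \<noteq> {}" and "bdd_above ((\<lambda>w. w x) ` convex_minorants \<Omega> g)"
proof -
  obtain M where M: "\<And>y. y \<in> frontier \<Omega> \<Longrightarrow> \<bar>g y\<bar> \<le> M"
    using g by (auto simp: bounded_iff)
  have "(\<lambda>_. - M) \<in> convex_minorants \<Omega> g"
    using M by (force simp: convex_minorants_def convex_on_const abs_le_iff)
  then show "convex_minorants \<Omega> g \<noteq> {}" by blast
  obtain l :: "real^'n" where l: "l \<noteq> 0"
    using vector_choose_size[of 1] by (metis norm_zero zero_le_one zero_neq_one)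
  have xi: "x \<in> interior \<Omega>" using assms by (simp add: interior_open)
  obtain d where d: "0 < d" "x + d *\<^sub>R l \<in> frontier \<Omega>"
    using ray_to_frontier[OF \<open>bounded \<Omega>\<close> xi l] by metis
  obtain e where e: "0 < e" "x + e *\<^sub>R (- l) \<in> frontier \<Omega>"
    using ray_to_frontier[OF \<open>bounded \<Omega>\<close> xi, of "- l"] l by (metis neg_equal_0_iff_equal)
  have "x \<in> closed_segment (x + d *\<^sub>R l) (x + e *\<^sub>R (- l))"
  proof -
    have "x = (1 - d / (d + e)) *\<^sub>R (x + d *\<^sub>R l) + (d / (d + e)) *\<^sub>R (x + e *\<^sub>R (- l))"
    proof -
      have "(1 - d / (d + e)) * d = (d / (d + e)) * e"
        using d e by (simp add: field_simps)
      then show ?thesis by (simp add: algebra_simps flip: scaleR_add_left)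
    qed
    then show ?thesis
      using d e unfolding in_segment by (intro exI[of _ "d / (d + e)"]) auto
  qed
  moreover have "w x \<le> M"
    if w: "w \<in> convex_minorants \<Omega> g" "x \<in> closed_segment a b" "a \<in> frontier \<Omega>" "b \<in> frontier \<Omega>"
    for w a b
  proof -
    obtain t where t: "0 \<le> t" "t \<le> 1" "x = (1 - t) *\<^sub>R a + t *\<^sub>R b"
      using w(2) by (auto simp: in_segment)
    have cv: "convex_on UNIV w" and le: "w a \<le> M" "w b \<le> M"
      using w M by (force simp: convex_minorants_def abs_le_iff)+
    have "w x \<le> (1 - t) * w a + t * w b"
      using convex_onD[OF cv t(1,2)] t(3) by simp
    also have "\<dots> \<le> M" using le t by (intro convex_bound_le) auto
    finally show ?thesis .
  qed
  ultimately show "bdd_above ((\<lambda>w. w x) ` convex_minorants \<Omega> g)"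
    using d e by (intro bdd_aboveI[of _ M]) blast
qed

definition second_dir_quotient :: "(real^'n \<Rightarrow> real) \<Rightarrow> real^'n \<Rightarrow> real^'n \<Rightarrow> real \<Rightarrow> real \<Rightarrow> real" where
  "second_dir_quotient u x v h k =
     2 / (h + k) * ((u (x + k *\<^sub>R v) - u x) / k - (u x - u (x - h *\<^sub>R v)) / h)"

text \<open>The limit may be infinite; the product filter lets \<open>h\<close> and \<open>k\<close> vary independently.\<close>

definition has_second_dir_deriv ::
    "(real^'n \<Rightarrow> real) \<Rightarrow> real^'n \<Rightarrow> real^'n \<Rightarrow> ereal \<Rightarrow> bool" where
  "has_second_dir_deriv u x v l \<longleftrightarrow>
     ((\<lambda>(h, k). ereal (second_dir_quotient u x v h k)) \<longlongrightarrow> l) (at_right 0 \<times>\<^sub>F at_right 0)"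

definition second_dir_derivs :: "(real^'n \<Rightarrow> real) \<Rightarrow> real^'n \<Rightarrow> ereal set" where
  "second_dir_derivs u x = {l. \<exists>v. norm v = 1 \<and> has_second_dir_deriv u x v l}"

text \<open>
  \<open>LEAST\<close> is unspecified if the minimum is not attained, so a statement about \<open>lambda1\<close>
  has to assert attainment separately.
\<close>

definition lambda1 :: "(real^'n \<Rightarrow> real) \<Rightarrow> real^'n \<Rightarrow> ereal" where
  "lambda1 u x = (LEAST l. l \<in> second_dir_derivs u x)"

end

theory Submission
  imports Defs
begin

text \<open>
  Write \<open>u\<close> for the convex envelope. Near \<open>x\<close> it is a supremum of convex functions that is
  finite, hence convex, so its second difference quotients are nonnegative and every second
  directional derivative at \<open>x\<close> is nonnegative. It remains to find a direction along which \<open>u\<close>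
  is affine near \<open>x\<close>.

  Since \<open>g\<close> is only bounded, the supremum need not see the values of \<open>g\<close> itself, but only their
  lower limits. So \<open>g\<close> is replaced by the closure \<open>G\<close> of its graph over \<open>frontier \<Omega>\<close>. This is a
  compact set, and a convex minorant, being continuous, still lies below it, hence below its
  convex hull. The central fact (\<open>envelope_in_hull_closure_graph\<close>) is that the point \<open>(x, u x)\<close>
  belongs to \<open>convex hull G\<close>: otherwise the vertical half-line below it could be strictly
  separated from the hull, and the separating hyperplane would be the graph of an affine minorant
  whose value at \<open>x\<close> exceeds \<open>u x\<close>.

  The point \<open>(x, u x)\<close> is no extreme point of the hull, because extreme points lie in \<open>G\<close>, thus
  over the frontier, while \<open>x\<close> is in the open set \<open>\<Omega>\<close>. So \<open>(x, u x)\<close> is in the interior of a chord of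
  the hull (\<open>envelope_touches_chord\<close>). The envelope lies below this chord and meets it
  at an interior point of it; by convexity it coincides with the chord near \<open>x\<close>
  (\<open>envelope_affine_in_some_direction\<close>), and the second derivative in that direction is zero.
\<close>

section \<open>Convexity of the envelope\<close>

lemma convex_on_convex_envelope:
  fixes \<Omega> :: "(real^'n) set" and g :: "real^'n \<Rightarrow> real"
  assumes "open \<Omega>" "bounded \<Omega>" "bounded (g ` frontier \<Omega>)"
    and S: "convex S" "S \<subseteq> \<Omega>"
  shows "convex_on S (convex_envelope \<Omega> g)"
proof (rule convex_onI)
  note wd = convex_envelope_well_defined[OF assms(1-3)]
  fix t :: real and y z
  assume t: "0 < t" "t < 1" and yz: "y \<in> S" "z \<in> S"
  have "w ((1 - t) *\<^sub>R y + t *\<^sub>R z) \<le> (1 - t) * convex_envelope \<Omega> g y + t * convex_envelope \<Omega> g z"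
    if w: "w \<in> convex_minorants \<Omega> g" for w
  proof -
    have "w ((1 - t) *\<^sub>R y + t *\<^sub>R z) \<le> (1 - t) * w y + t * w z"
      using w t convex_onD[of UNIV w t y z] by (auto simp: convex_minorants_def)
    also have "\<dots> \<le> (1 - t) * convex_envelope \<Omega> g y + t * convex_envelope \<Omega> g z"
      unfolding convex_envelope_def
      using t w wd(2)[of y] wd(2)[of z] yz S
      by (intro add_mono mult_left_mono cSUP_upper) auto
    finally show ?thesis .
  qed
  then show "convex_envelope \<Omega> g ((1 - t) *\<^sub>R y + t *\<^sub>R z)
      \<le> (1 - t) * convex_envelope \<Omega> g y + t * convex_envelope \<Omega> g z"
    using wd(1) yz S unfolding convex_envelope_def[of _ _ "_ + _"]
    by (intro cSUP_least) auto
qed (rule S)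

text \<open>
  Writing \<open>x\<close> as the convex combination of \<open>x - h *\<^sub>R v\<close> and \<open>x + k *\<^sub>R v\<close> with weights
  \<open>k / (h + k)\<close> and \<open>h / (h + k)\<close> turns convexity into the comparison of the two slopes.
\<close>

lemma second_dir_quotient_nonneg:
  fixes u :: "real^'n \<Rightarrow> real"
  assumes u: "convex_on S u" and hk: "0 < h" "0 < k"
    and S: "x - h *\<^sub>R v \<in> S" "x + k *\<^sub>R v \<in> S"
  shows "0 \<le> second_dir_quotient u x v h k"
proof -
  define t where "t = h / (h + k)"
  have t: "0 \<le> t" "t \<le> 1" "1 - t = k / (h + k)"
    using hk by (auto simp: t_def field_simps)
  have "(1 - t) * h = t * k"
    using hk by (simp add: t(3)) (simp add: t_def)
  then have "(1 - t) *\<^sub>R (x - h *\<^sub>R v) + t *\<^sub>R (x + k *\<^sub>R v) = x"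
    by (simp add: algebra_simps flip: scaleR_add_left)
  then have "u x \<le> (1 - t) * u (x - h *\<^sub>R v) + t * u (x + k *\<^sub>R v)"
    using convex_onD[OF u t(1,2) S] by simp
  then have "(h + k) * u x \<le> (h + k) * ((1 - t) * u (x - h *\<^sub>R v) + t * u (x + k *\<^sub>R v))"
    using hk by (intro mult_left_mono) auto
  also have "\<dots> = ((h + k) * (1 - t)) * u (x - h *\<^sub>R v) + ((h + k) * t) * u (x + k *\<^sub>R v)"
    by (simp only: distrib_left mult.assoc)
  also have "(h + k) * (1 - t) = k"
    using hk by (simp add: t(3))
  also have "(h + k) * t = h"
    using hk by (simp add: t_def)
  finally have "(h + k) * u x \<le> k * u (x - h *\<^sub>R v) + h * u (x + k *\<^sub>R v)" .
  then have "(u x - u (x - h *\<^sub>R v)) / h \<le> (u (x + k *\<^sub>R v) - u x) / k"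
    using hk by (simp add: field_simps)
  then show ?thesis
    unfolding second_dir_quotient_def using hk by (intro mult_nonneg_nonneg) auto
qed

lemma eventually_small_steps:
  assumes "0 < (e::real)"
  shows "eventually (\<lambda>(h, k). 0 < h \<and> h < e \<and> 0 < k \<and> k < e) (at_right 0 \<times>\<^sub>F at_right 0)"
proof -
  have "eventually (\<lambda>h. 0 < h \<and> h < e) (at_right 0)"
    using assms eventually_at_right_real[of 0 e] by simp
  from eventually_prodI[OF this this] show ?thesis
    by (rule eventually_mono) auto
qed

lemma second_dir_deriv_nonneg:
  fixes u :: "real^'n \<Rightarrow> real"
  assumes u: "convex_on (ball x e) u" and e: "0 < e" and v: "norm v = 1"
    and l: "has_second_dir_deriv u x v l"
  shows "0 \<le> l"
proof (rule tendsto_lowerbound)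
  show "((\<lambda>(h, k). ereal (second_dir_quotient u x v h k)) \<longlongrightarrow> l) (at_right 0 \<times>\<^sub>F at_right 0)"
    using l by (simp add: has_second_dir_deriv_def)
  show "\<forall>\<^sub>F p in at_right 0 \<times>\<^sub>F at_right 0. 0 \<le> (case p of (h, k) \<Rightarrow> ereal (second_dir_quotient u x v h k))"
    using eventually_small_steps[OF e]
    by (rule eventually_mono)
      (use v in \<open>auto simp: dist_norm zero_ereal_def intro!: second_dir_quotient_nonneg[OF u]\<close>)
  show "at_right (0::real) \<times>\<^sub>F at_right (0::real) \<noteq> bot"
    by (simp add: prod_filter_eq_bot)
qed

section \<open>The convex hull of the closed graph of the boundary data\<close>

definition closure_graph :: "(real^'n) set \<Rightarrow> (real^'n \<Rightarrow> real) \<Rightarrow> ((real^'n) \<times> real) set" where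
  "closure_graph \<Omega> g = closure ((\<lambda>y. (y, g y)) ` frontier \<Omega>)"

lemma compact_closure_graph:
  fixes \<Omega> :: "(real^'n) set"
  assumes "bounded \<Omega>" "bounded (g ` frontier \<Omega>)"
  shows "compact (closure_graph \<Omega> g)"
proof -
  have "bounded (frontier \<Omega> \<times> g ` frontier \<Omega>)"
    using assms by (intro bounded_Times compact_imp_bounded[OF compact_frontier_bounded])
  then have "bounded ((\<lambda>y. (y, g y)) ` frontier \<Omega>)"
    by (rule bounded_subset) auto
  then show ?thesis
    by (simp add: closure_graph_def compact_closure)
qed

lemma closure_graph_over_frontier:
  fixes \<Omega> :: "(real^'n) set"
  assumes "(y, t) \<in> closure_graph \<Omega> g"
  shows "y \<in> frontier \<Omega>"
proof -
  have "closure_graph \<Omega> g \<subseteq> frontier \<Omega> \<times> UNIV"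
    unfolding closure_graph_def
    by (rule closure_minimal) (auto intro: closed_Times)
  then show ?thesis using assms by auto
qed

text \<open>
  Finite convex functions on the whole space are continuous, so the epigraph of a minorant is a
  closed convex set.
\<close>

lemma minorant_le_hull_closure_graph:
  fixes \<Omega> :: "(real^'n) set"
  assumes w: "w \<in> convex_minorants \<Omega> g" and yt: "(y, t) \<in> convex hull closure_graph \<Omega> g"
  shows "w y \<le> t"
proof -
  have cw: "convex_on UNIV w" and le: "\<And>y. y \<in> frontier \<Omega> \<Longrightarrow> w y \<le> g y"
    using w by (auto simp: convex_minorants_def)
  have epi: "epigraph UNIV w = {p. w (fst p) \<le> snd p}"
    by (auto simp: epigraph_def)
  have "continuous_on UNIV w"
    using cw by (intro convex_on_continuous) auto
  then have "continuous_on UNIV (\<lambda>p. w (fst p))"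
    by (rule continuous_on_compose2) (auto intro: continuous_on_fst continuous_on_id)
  then have "closed (epigraph UNIV w)"
    unfolding epi by (intro closed_Collect_le continuous_intros) auto
  then have "closure_graph \<Omega> g \<subseteq> epigraph UNIV w"
    unfolding closure_graph_def
    by (intro closure_minimal) (auto simp: epi le)
  moreover have "convex (epigraph UNIV w)"
    using cw by (simp add: convex_epigraph)
  ultimately have "convex hull closure_graph \<Omega> g \<subseteq> epigraph UNIV w"
    by (intro hull_minimal) auto
  then show ?thesis using yt by (auto simp: epi)
qed

lemma envelope_le_hull_closure_graph:
  fixes \<Omega> :: "(real^'n) set"
  assumes "convex_minorants \<Omega> g \<noteq> {}" "(y, t) \<in> convex hull closure_graph \<Omega> g"
  shows "convex_envelope \<Omega> g y \<le> t"
  unfolding convex_envelope_def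
  using assms by (intro cSUP_least) (auto intro: minorant_le_hull_closure_graph)

text \<open>
  The half-line below \<open>(x, u x)\<close>, rather than the point alone, is separated from the hull: being
  unbounded downwards, it forces the vertical component of the normal vector to be nonnegative. The
  component is not zero either, since moving from \<open>x\<close> against the horizontal component leads to
  a point of the frontier on the wrong side. Hence the hyperplane is the graph of an affine function.
\<close>

lemma envelope_in_hull_closure_graph:
  fixes \<Omega> :: "(real^'n) set" and g :: "real^'n \<Rightarrow> real"
  assumes "open \<Omega>" "bounded \<Omega>" "bounded (g ` frontier \<Omega>)" and x: "x \<in> \<Omega>"
  shows "(x, convex_envelope \<Omega> g x) \<in> convex hull closure_graph \<Omega> g"
proof (rule ccontr)
  assume notin: "(x, convex_envelope \<Omega> g x) \<notin> convex hull closure_graph \<Omega> g"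
  note wd = convex_envelope_well_defined[OF assms]
  define u where "u = convex_envelope \<Omega> g x"
  have xi: "x \<in> interior \<Omega>" using assms(1) x by (simp add: interior_open)
  have graph: "(y, g y) \<in> convex hull closure_graph \<Omega> g" if "y \<in> frontier \<Omega>" for y
    using that by (intro hull_inc) (auto simp: closure_graph_def intro: subsetD[OF closure_subset])
  have "(x, t) \<notin> convex hull closure_graph \<Omega> g" if "t \<le> u" for t
    using envelope_le_hull_closure_graph[OF wd(1), of x t] that notin
    by (auto simp: u_def)
  then have disj: "({x} \<times> {..u}) \<inter> convex hull closure_graph \<Omega> g = {}"
    by auto
  obtain l :: "real^'n" where l: "l \<noteq> 0"
    using vector_choose_size[of 1] by (metis norm_zero zero_le_one zero_neq_one)
  then obtain d where "x + d *\<^sub>R l \<in> frontier \<Omega>"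
    using ray_to_frontier[OF assms(2) xi] by metis
  then have ne: "convex hull closure_graph \<Omega> g \<noteq> {}"
    using graph by blast
  have "\<exists>n c. (\<forall>p\<in>{x} \<times> {..u}. n \<bullet> p < c) \<and> (\<forall>p\<in>convex hull closure_graph \<Omega> g. n \<bullet> p > c)"
    using disj ne compact_convex_hull[OF compact_closure_graph[OF assms(2,3)]]
    by (intro separating_hyperplane_closed_compact) (auto intro: convex_Times closed_Times)
  then obtain n c where "\<forall>p\<in>{x} \<times> {..u}. n \<bullet> p < c"
      "\<forall>p\<in>convex hull closure_graph \<Omega> g. n \<bullet> p > c"
    by blast
  moreover obtain a b where "n = (a, b)" by (cases n)
  ultimately have below: "\<And>t. t \<le> u \<Longrightarrow> a \<bullet> x + b * t < c"
    and above: "\<And>y. y \<in> frontier \<Omega> \<Longrightarrow> c < a \<bullet> y + b * g y"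
    using graph by (fastforce simp: inner_Pair)+
  have "0 \<le> b"
  proof (rule ccontr)
    assume b: "\<not> 0 \<le> b"
    \<comment> \<open>For \<open>b < 0\<close>, every height up to \<open>(c - a \<bullet> x) / b\<close> over \<open>x\<close> violates the inequality \<open>below\<close>.\<close>
    define t where "t = min u ((c - a \<bullet> x) / b)"
    have "b * ((c - a \<bullet> x) / b) \<le> b * t"
      using b by (intro mult_left_mono_neg) (auto simp: t_def)
    then show False
      using below[of t] b by (simp add: t_def)
  qed
  moreover have "b \<noteq> 0"
  proof
    assume b: "b = 0"
    show False
    proof (cases "a = 0")
      case True
      then show False using above[OF \<open>x + d *\<^sub>R l \<in> frontier \<Omega>\<close>] below[of u] b by simp
    next
      case False
      then obtain e where e: "0 < e" "x + e *\<^sub>R (- a) \<in> frontier \<Omega>"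
        using ray_to_frontier[OF assms(2) xi, of "- a"] by auto
      have "a \<bullet> (x + e *\<^sub>R (- a)) \<le> a \<bullet> x"
        using e(1) by (simp add: inner_diff_right)
      then show False using above[OF e(2)] below[of u] b by simp
    qed
  qed
  ultimately have b: "0 < b" by simp
  define w where "w = (\<lambda>y. (c - a \<bullet> y) / b)"
  have "convex_on UNIV w"
  proof (rule convex_onI)
    fix t :: real and y z
    show "w ((1 - t) *\<^sub>R y + t *\<^sub>R z) \<le> (1 - t) * w y + t * w z"
      by (simp add: w_def inner_add_right inner_diff_right diff_divide_distrib add_divide_distrib
          algebra_simps)
  qed simp
  moreover have "w y \<le> g y" if "y \<in> frontier \<Omega>" for y
    using above[OF that] b by (simp add: w_def field_simps)
  ultimately have "w \<in> convex_minorants \<Omega> g"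
    by (auto simp: convex_minorants_def)
  then have "w x \<le> u"
    unfolding u_def convex_envelope_def using wd(2) by (intro cSUP_upper)
  moreover have "u < w x"
    using below[of u] b by (simp add: w_def field_simps)
  ultimately show False by simp
qed

section \<open>A direction in which the envelope is affine\<close>

text \<open>
  The endpoints of the chord through the non-extreme point \<open>(x, u x)\<close> lie over different points:
  on a vertical chord, one endpoint would be below \<open>(x, u x)\<close>, but the envelope is a lower bound for
  the hull.
\<close>

lemma envelope_touches_chord:
  fixes \<Omega> :: "(real^'n) set" and g :: "real^'n \<Rightarrow> real"
  assumes "open \<Omega>" "bounded \<Omega>" "bounded (g ` frontier \<Omega>)" and x: "x \<in> \<Omega>"
  obtains a b s t \<theta> where
    "(a, s) \<in> convex hull closure_graph \<Omega> g" "(b, t) \<in> convex hull closure_graph \<Omega> g"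
    "a \<noteq> b" "0 < \<theta>" "\<theta> < 1" "x = (1 - \<theta>) *\<^sub>R a + \<theta> *\<^sub>R b"
    "convex_envelope \<Omega> g x = (1 - \<theta>) * s + \<theta> * t"
proof -
  define u where "u = convex_envelope \<Omega> g"
  let ?H = "convex hull closure_graph \<Omega> g"
  note wd = convex_envelope_well_defined[OF assms]
  have "x \<notin> frontier \<Omega>"
    using assms(1) x by (simp add: frontier_def interior_open)
  then have "(x, u x) \<notin> closure_graph \<Omega> g"
    using closure_graph_over_frontier by blast
  then have "\<not> (x, u x) extreme_point_of ?H"
    using extreme_point_of_convex_hull by blast
  moreover have "(x, u x) \<in> ?H"
    unfolding u_def by (rule envelope_in_hull_closure_graph[OF assms])
  ultimately obtain p q where pq: "p \<in> ?H" "q \<in> ?H" "(x, u x) \<in> open_segment p q"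
    by (auto simp: extreme_point_of_def)
  obtain a s b t where ab: "p = (a, s)" "q = (b, t)" by (cases p, cases q)
  obtain \<theta> where \<theta>: "0 < \<theta>" "\<theta> < 1" "x = (1 - \<theta>) *\<^sub>R a + \<theta> *\<^sub>R b" "u x = (1 - \<theta>) * s + \<theta> * t"
    using pq(3) unfolding ab in_segment by auto
  have "a \<noteq> b"
  proof
    assume eq: "a = b"
    then have "x = a" using \<theta>(3) by (simp flip: scaleR_add_left)
    then have le: "u x \<le> s" "u x \<le> t"
      using pq(1,2) eq envelope_le_hull_closure_graph[OF wd(1)] by (auto simp: ab u_def)
    have "(1 - \<theta>) * (s - u x) + \<theta> * (t - u x) = 0"
      using \<theta>(4) by (simp add: algebra_simps)
    then have "s = u x" "t = u x"
      using le \<theta>(1,2) by (auto simp: add_nonneg_eq_0_iff)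
    then have "p = q" using eq by (simp add: ab)
    then show False using pq(3) by simp
  qed
  then show ?thesis
    using that[of a s b t \<theta>] pq(1,2) \<theta> by (simp add: ab u_def)
qed

text \<open>
  The bound from above is the chord. The bound from below is the midpoint inequality
  at \<open>x\<close> for the points \<open>x + r *\<^sub>R v\<close> and \<open>x - r *\<^sub>R v\<close>, with the upper bound inserted for the latter.
\<close>

lemma envelope_affine_in_some_direction:
  fixes \<Omega> :: "(real^'n) set" and g :: "real^'n \<Rightarrow> real"
  assumes "open \<Omega>" "bounded \<Omega>" "bounded (g ` frontier \<Omega>)" and x: "x \<in> \<Omega>"
  obtains v m e where "norm v = 1" "0 < e"
    "\<And>r. \<bar>r\<bar> < e \<Longrightarrow> convex_envelope \<Omega> g (x + r *\<^sub>R v) = convex_envelope \<Omega> g x + r * m"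
proof -
  define u where "u = convex_envelope \<Omega> g"
  note wd = convex_envelope_well_defined[OF assms]
  obtain a b s t \<theta> where H: "(a, s) \<in> convex hull closure_graph \<Omega> g"
      "(b, t) \<in> convex hull closure_graph \<Omega> g"
    and ab: "a \<noteq> b" and \<theta>: "0 < \<theta>" "\<theta> < 1" "x = (1 - \<theta>) *\<^sub>R a + \<theta> *\<^sub>R b"
      "u x = (1 - \<theta>) * s + \<theta> * t"
    using envelope_touches_chord[OF assms] unfolding u_def by metis
  define L where "L = norm (b - a)"
  have L: "0 < L" using ab by (simp add: L_def)
  define v where "v = (1 / L) *\<^sub>R (b - a)"
  define m where "m = (t - s) / L"
  have v: "norm v = 1" using L by (simp add: v_def L_def)
  obtain \<epsilon> where \<epsilon>: "0 < \<epsilon>" "ball x \<epsilon> \<subseteq> \<Omega>"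
    using assms(1) x openE by blast
  define e where "e = min \<epsilon> (min (L * \<theta>) (L * (1 - \<theta>)))"
  have e: "0 < e" using \<epsilon> L \<theta> by (simp add: e_def)
  have upper: "u (x + r *\<^sub>R v) \<le> u x + r * m" if r: "\<bar>r\<bar> < e" for r
  proof -
    \<comment> \<open>the chord parameter of the point \<open>x + r *\<^sub>R v\<close>\<close>
    define \<eta> where "\<eta> = \<theta> + r / L"
    have "\<bar>r\<bar> < L * \<theta>" "\<bar>r\<bar> < L * (1 - \<theta>)" using r by (auto simp: e_def)
    then have "0 \<le> \<eta>" "\<eta> \<le> 1"
      using L by (auto simp: \<eta>_def field_simps abs_less_iff)
    then have "(1 - \<eta>) *\<^sub>R (a, s) + \<eta> *\<^sub>R (b, t) \<in> convex hull closure_graph \<Omega> g"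
      using H by (intro convexD_alt) auto
    moreover have "(1 - \<eta>) *\<^sub>R (a, s) + \<eta> *\<^sub>R (b, t) = (x + r *\<^sub>R v, u x + r * m)"
      using L unfolding \<eta>_def \<theta>(3) v_def m_def \<theta>(4)[unfolded \<theta>(3)]
      by (simp add: algebra_simps add_divide_distrib diff_divide_distrib)
    ultimately show ?thesis
      unfolding u_def using envelope_le_hull_closure_graph[OF wd(1)] by simp
  qed
  have "u (x + r *\<^sub>R v) = u x + r * m" if r: "\<bar>r\<bar> < e" for r
  proof (rule antisym[OF upper[OF r]])
    have "convex_on (ball x \<epsilon>) u"
      unfolding u_def using assms(1-3) \<epsilon>(2) by (intro convex_on_convex_envelope) auto
    moreover have "x + r *\<^sub>R v \<in> ball x \<epsilon>" "x + (- r) *\<^sub>R v \<in> ball x \<epsilon>"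
      using r v by (auto simp: dist_norm e_def)
    ultimately have "u ((1 - 1/2) *\<^sub>R (x + r *\<^sub>R v) + (1/2) *\<^sub>R (x + (- r) *\<^sub>R v))
        \<le> (1 - 1/2) * u (x + r *\<^sub>R v) + (1/2) * u (x + (- r) *\<^sub>R v)"
      by (intro convex_onD) auto
    moreover have "(1 - 1/2) *\<^sub>R (x + r *\<^sub>R v) + (1/2) *\<^sub>R (x + (- r) *\<^sub>R v) = x"
      by (simp add: algebra_simps flip: scaleR_add_left)
    moreover have "u (x + (- r) *\<^sub>R v) \<le> u x + (- r) * m"
      using r by (intro upper) simp
    ultimately show "u x + r * m \<le> u (x + r *\<^sub>R v)" by simp
  qed
  then show ?thesis using that v e by (auto simp: u_def)
qed

lemma has_second_dir_deriv_zero_if_affine: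
  fixes u :: "real^'n \<Rightarrow> real"
  assumes e: "0 < e" and u: "\<And>r. \<bar>r\<bar> < e \<Longrightarrow> u (x + r *\<^sub>R v) = u x + r * m"
  shows "has_second_dir_deriv u x v 0"
proof -
  have "second_dir_quotient u x v h k = 0" if "0 < h" "h < e" "0 < k" "k < e" for h k
    using that u[of k] u[of "- h"] by (simp add: second_dir_quotient_def)
  then have "\<forall>\<^sub>F p in at_right 0 \<times>\<^sub>F at_right 0.
      (case p of (h, k) \<Rightarrow> ereal (second_dir_quotient u x v h k)) = 0"
    by (intro eventually_mono[OF eventually_small_steps[OF e]]) auto
  then show ?thesis
    unfolding has_second_dir_deriv_def by (rule tendsto_eventually)
qed

section \<open>The smallest second directional derivative\<close>

theorem corollary3p4:
  fixes \<Omega> :: "(real^'n) set" and g :: "real^'n \<Rightarrow> real" and x :: "real^'n"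
  assumes "open \<Omega>" and "connected \<Omega>" and "bounded \<Omega>"
    and "bounded (g ` frontier \<Omega>)"
    and "x \<in> \<Omega>"
  shows "0 \<in> second_dir_derivs (convex_envelope \<Omega> g) x
    \<and> (\<forall>l \<in> second_dir_derivs (convex_envelope \<Omega> g) x. 0 \<le> l)
    \<and> lambda1 (convex_envelope \<Omega> g) x = 0"
proof -
  obtain v m e where "norm v = 1" "0 < e"
    "\<And>r. \<bar>r\<bar> < e \<Longrightarrow> convex_envelope \<Omega> g (x + r *\<^sub>R v) = convex_envelope \<Omega> g x + r * m"
    using envelope_affine_in_some_direction[OF assms(1,3,4,5)] by metis
  then have zero: "0 \<in> second_dir_derivs (convex_envelope \<Omega> g) x"
    using has_second_dir_deriv_zero_if_affine unfolding second_dir_derivs_def by blast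
  obtain \<epsilon> where \<epsilon>: "0 < \<epsilon>" "ball x \<epsilon> \<subseteq> \<Omega>"
    using assms(1,5) openE by blast
  have "convex_on (ball x \<epsilon>) (convex_envelope \<Omega> g)"
    using assms(1,3,4) \<epsilon>(2) by (intro convex_on_convex_envelope) auto
  then have nonneg: "\<forall>l \<in> second_dir_derivs (convex_envelope \<Omega> g) x. 0 \<le> l"
    using second_dir_deriv_nonneg \<epsilon>(1) unfolding second_dir_derivs_def by blast
  have "lambda1 (convex_envelope \<Omega> g) x = 0"
    unfolding lambda1_def using zero nonneg by (intro Least_equality) auto
  then show ?thesis using zero nonneg by simp
qed

end
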